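(* Let $n\ge 1$. The Laplace transform $\mathcal{L}:\mathcal{K}_n^n\to C(\mathbb{R}^n)$, $\mathcal{L}K(x)=\int_K e^{-x\cdot y}\,dy$, is a continuous, positively $\mathrm{GL}(n)$ covariant and logarithmic translation covariant valuation on $\mathcal{K}_n^n$.
   Context: $\mathcal{K}_n^n$ is the set of $n$-dimensional convex bodies in $\mathbb{R}^n$, i.e. compact convex subsets of $\mathbb{R}^n$ of dimension $n$ (nonempty interior). $C(\mathbb{R}^n)$ is the space of continuous real-valued functions on $\mathbb{R}^n$. Definitions for a map $Z:\mathcal{K}_n^n\to C(\mathbb{R}^n)$: - valuation: $Z(K\cup L)+Z(K\cap L)=ZK+ZL$ whenever $K,L,K\cup L,K\cap L\in\mathcal{K}_n^n$; - continuous: for every $x\in\mathbb{R}^n$, $ZK_i(x)\to ZK(x)$ whenever $K_i,K\in\mathcal{K}_n^n$ and $K_i\to K$ in the Hausdorff metric; - positively $\mathrm{GL}(n)$ covariant: $Z(\phi K)(x)=|\det\phi|\,ZK(\phi^t x)$ for all $K\in\mathcal{K}_n^n$, $x\in\mathbb{R}^n$ and all $\phi\in\mathrm{GL}(n)$ with positive determinant; - logarithmic translation covariant: $Z(K+t)(x)=e^{-t\cdot x}ZK(x)$ for all $K\in\mathcal{K}_n^n$ and $t,x\in\mathbb{R}^n$. *)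

theory Defs
  imports "HOL-Analysis.Analysis"
begin

definition convex_bodies :: "(real ^ 'n) set set" where
  "convex_bodies = {K. convex K \<and> compact K \<and> interior K \<noteq> {}}"

(* The suprema are over nonempty, bounded-above sets whenever A and B are nonempty and bounded;
   this covers all convex bodies. *)
definition hausdorff_distance :: "'a::metric_space set \<Rightarrow> 'a set \<Rightarrow> real" where
  "hausdorff_distance A B = max (SUP a\<in>A. infdist a B) (SUP b\<in>B. infdist b A)"

(* A map Z on the n-dimensional convex bodies is represented by a total function on sets;
   the predicates below only constrain its values on convex_bodies. *)

definition valuation :: "((real ^ 'n) set \<Rightarrow> real ^ 'n \<Rightarrow> real) \<Rightarrow> bool" where
  "valuation Z \<longleftrightarrow>
     (\<forall>K L. K \<in> convex_bodies \<longrightarrow> L \<in> convex_bodies \<longrightarrow>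
            K \<union> L \<in> convex_bodies \<longrightarrow> K \<inter> L \<in> convex_bodies \<longrightarrow>
            (\<forall>x. Z (K \<union> L) x + Z (K \<inter> L) x = Z K x + Z L x))"

definition hausdorff_continuous :: "((real ^ 'n) set \<Rightarrow> real ^ 'n \<Rightarrow> real) \<Rightarrow> bool" where
  "hausdorff_continuous Z \<longleftrightarrow>
     (\<forall>x Ks K. (\<forall>i::nat. Ks i \<in> convex_bodies) \<longrightarrow> K \<in> convex_bodies \<longrightarrow>
            (\<lambda>i. hausdorff_distance (Ks i) K) \<longlonglongrightarrow> 0 \<longrightarrow>
            (\<lambda>i. Z (Ks i) x) \<longlonglongrightarrow> Z K x)"

definition positively_GL_covariant :: "((real ^ 'n) set \<Rightarrow> real ^ 'n \<Rightarrow> real) \<Rightarrow> bool" where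
  "positively_GL_covariant Z \<longleftrightarrow>
     (\<forall>K \<in> convex_bodies. \<forall>x. \<forall>\<phi> :: real ^ 'n ^ 'n. invertible \<phi> \<longrightarrow> det \<phi> > 0 \<longrightarrow>
            Z ((\<lambda>y. \<phi> *v y) ` K) x = \<bar>det \<phi>\<bar> * Z K (transpose \<phi> *v x))"

definition log_translation_covariant :: "((real ^ 'n) set \<Rightarrow> real ^ 'n \<Rightarrow> real) \<Rightarrow> bool" where
  "log_translation_covariant Z \<longleftrightarrow>
     (\<forall>K \<in> convex_bodies. \<forall>t x. Z ((\<lambda>y. y + t) ` K) x = exp (- (t \<bullet> x)) * Z K x)"

definition laplace_transform :: "(real ^ 'n) set \<Rightarrow> real ^ 'n \<Rightarrow> real" where
  "laplace_transform K x = (LINT y:K|lborel. exp (- (x \<bullet> y)))"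

end

theory Submission
  imports Defs
begin

text \<open>Covariance is the change of variables formula. For continuity, if convex bodies converge to \<open>K\<close>
  in the Hausdorff metric, then their indicator functions converge to that of \<open>K\<close> off the frontier
  of \<open>K\<close>, which is a null set: a point of the interior that is missed by one of the bodies can be
  separated from it, so that \<open>K\<close> contains a point far from that body. As the bodies are eventually
  uniformly bounded, dominated convergence applies, and it also yields continuity in \<open>x\<close>.\<close>

subsection \<open>Lebesgue measure under invertible matrices\<close>

text \<open>By Fubini with the \<open>e\<close>-coordinate innermost: since
  \<open>b \<noteq> e\<close>, the amount \<open>c * (x \<bullet> b)\<close> is constant along each
  line parallel to \<open>e\<close>, so the shear acts there as a translation.\<close>

lemma nn_integral_lborel_shear:
  fixes e b :: "'a::euclidean_space" and g :: "'a \<Rightarrow> ennreal"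
  assumes e: "e \<in> Basis" and b: "b \<in> Basis" "b \<noteq> e" and [measurable]: "g \<in> borel_measurable borel"
  shows "(\<integral>\<^sup>+x. g (x + (c * (x \<bullet> b)) *\<^sub>R e) \<partial>lborel) = (\<integral>\<^sup>+x. g x \<partial>lborel)"
proof -
  \<comment> \<open>\<open>S\<close> assembles a vector from its coordinates; \<open>lborel\<close>
    is the image of the product measure under it.\<close>
  define S where "S f = (\<Sum>j\<in>Basis. f j *\<^sub>R j)" for f :: "'a \<Rightarrow> real"
  interpret product_sigma_finite "\<lambda>_::'a. lborel :: real measure" ..
  have [measurable]: "S \<in> borel_measurable (\<Pi>\<^sub>M j\<in>Basis. lborel)"
    unfolding S_def by measurable
  have Basis: "Basis = insert e (Basis - {e})"
    using e by auto
  \<comment> \<open>Stated for arbitrary \<open>h\<close>, because it is applied both to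
    \<open>g\<close> and to \<open>g\<close> composed with the shear.\<close>
  have fubini: "(\<integral>\<^sup>+x. h x \<partial>lborel)
      = (\<integral>\<^sup>+f. (\<integral>\<^sup>+y. h (S (f(e := y))) \<partial>lborel) \<partial>(\<Pi>\<^sub>M j\<in>Basis - {e}. lborel))"
    if [measurable]: "h \<in> borel_measurable borel" for h :: "'a \<Rightarrow> ennreal"
  proof -
    have "(\<integral>\<^sup>+x. h x \<partial>lborel) = (\<integral>\<^sup>+f. h (S f) \<partial>(\<Pi>\<^sub>M j\<in>Basis. lborel))"
      by (subst lborel_eq) (simp add: nn_integral_distr S_def[abs_def, symmetric])
    also have "\<dots> = (\<integral>\<^sup>+f. h (S f) \<partial>(\<Pi>\<^sub>M j\<in>insert e (Basis - {e}). lborel))"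
      using Basis by simp
    also have "\<dots> = (\<integral>\<^sup>+f. (\<integral>\<^sup>+y. h (S (f(e := y))) \<partial>lborel) \<partial>(\<Pi>\<^sub>M j\<in>Basis - {e}. lborel))"
      using Basis by (intro product_nn_integral_insert) auto
    finally show ?thesis .
  qed
  have S_upd: "S (f(e := y)) = (\<Sum>j\<in>Basis - {e}. f j *\<^sub>R j) + y *\<^sub>R e" for f y
    unfolding S_def by (subst Basis, subst sum.insert) (auto intro: sum.cong)
  have S_inner: "S (f(e := y)) \<bullet> b = f b" for f y
    using b by (simp add: S_def inner_sum_left_Basis)
  have shift: "(\<integral>\<^sup>+y. g (S (f(e := y)) + (c * f b) *\<^sub>R e) \<partial>lborel) = (\<integral>\<^sup>+y. g (S (f(e := y))) \<partial>lborel)" for f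
  proof -
    have "(\<integral>\<^sup>+y. g (S (f(e := y))) \<partial>lborel)
        = (\<integral>\<^sup>+y. g (S (f(e := y))) \<partial>distr lborel borel ((+) (c * f b)))"
      by (simp add: lborel_distr_plus)
    also have "\<dots> = (\<integral>\<^sup>+y. g (S (f(e := c * f b + y))) \<partial>lborel)"
      unfolding S_upd by (rule nn_integral_distr) measurable
    also have "\<dots> = (\<integral>\<^sup>+y. g (S (f(e := y)) + (c * f b) *\<^sub>R e) \<partial>lborel)"
      unfolding S_upd by (simp add: algebra_simps)
    finally show ?thesis ..
  qed
  show ?thesis
    by (simp add: fubini S_inner shift)
qed

lemma prod_Basis_cart: "(\<Prod>b\<in>Basis. h b) = (\<Prod>i\<in>UNIV. h (axis i 1))" for h :: "real ^ 'n \<Rightarrow> 'b::comm_monoid_mult"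
proof -
  have Basis: "Basis = range (\<lambda>i::'n. axis i (1::real))"
    by (auto simp: Basis_vec_def)
  have inj: "inj (\<lambda>i::'n. axis i (1::real))"
    by (auto intro!: injI simp: axis_eq_axis)
  show ?thesis
    unfolding Basis prod.reindex[OF inj] o_def ..
qed

text \<open>Lebesgue measure is determined by its values on boxes, and the preimage of a box is a
  box with the same side lengths in another order.\<close>

lemma lborel_distr_permute_cart:
  assumes p: "p permutes UNIV"
  shows "distr lborel borel (\<lambda>x::real ^ 'n. \<chi> i. x $ p i) = lborel"
proof (rule sym, rule lborel_eqI)
  fix l u :: "real ^ 'n"
  assume le: "\<And>b. b \<in> Basis \<Longrightarrow> l \<bullet> b \<le> u \<bullet> b"
  then have lu: "l $ i \<le> u $ i" for i
    using le[of "axis i 1"] by (simp add: inner_axis)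
  define q where "q = inv p"
  have pq: "p (q i) = i" "q (p i) = i" for i
    using p by (auto simp: q_def permutes_inverses)
  have [measurable]: "(\<lambda>x::real ^ 'n. \<chi> i. x $ p i) \<in> borel_measurable borel"
    by (intro borel_measurable_continuous_onI continuous_intros)
  have "(\<lambda>x::real ^ 'n. \<chi> i. x $ p i) -` box l u = box (\<chi> i. l $ q i) (\<chi> i. u $ q i)"
    unfolding set_eq_iff by (auto simp: mem_box_cart) (metis pq)+
  then have "emeasure (distr lborel borel (\<lambda>x. \<chi> i. x $ p i)) (box l u)
      = emeasure lborel (box (\<chi> i. l $ q i) (\<chi> i. u $ q i))"
    by (simp add: emeasure_distr)
  also have "\<dots> = (\<Prod>i\<in>UNIV. u $ q i - l $ q i)"
  proof -
    \<comment> \<open>The volume of a box is the product of its side lengths only for ordered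
      corners, so the order is carried over to the permuted ones.\<close>
    have "\<forall>b\<in>Basis. (\<chi> i. l $ q i) \<bullet> b \<le> (\<chi> i. u $ q i) \<bullet> b"
      using lu by (auto simp: Basis_vec_def inner_axis)
    then show ?thesis
      by (simp add: emeasure_lborel_box_eq prod_Basis_cart inner_axis)
  qed
  also have "(\<Prod>i\<in>UNIV. u $ q i - l $ q i) = (\<Prod>i\<in>UNIV. u $ i - l $ i)"
    using prod.permute[OF permutes_inv[OF p], of "\<lambda>i. u $ i - l $ i"] by (simp add: q_def o_def)
  also have "\<dots> = (\<Prod>b\<in>Basis. (u - l) \<bullet> b)"
    by (simp add: prod_Basis_cart inner_axis)
  finally show "emeasure (distr lborel borel (\<lambda>x. \<chi> i. x $ p i)) (box l u) = (\<Prod>b\<in>Basis. (u - l) \<bullet> b)" .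
qed simp

text \<open>The matrix arises from the identity by adding \<open>c\<close> times row
  \<open>n\<close> to row \<open>m\<close>, which preserves the determinant.\<close>

lemma det_shear:
  fixes c :: "'a::comm_ring_1"
  assumes "m \<noteq> n"
  shows "det (\<chi> i j. if i = m \<and> j = n then c else of_bool (i = j) :: 'a ^ 'n ^ 'n) = 1"
proof -
  have "(\<chi> i j. if i = m \<and> j = n then c else of_bool (i = j) :: 'a ^ 'n ^ 'n)
      = (\<chi> k. if k = m then row m (mat 1) + c *s row n (mat 1) else row k (mat 1))"
    using assms by (auto simp: vec_eq_iff row_def mat_def)
  then show ?thesis
    using det_row_operation[OF assms, of "mat 1" c] by simp
qed

lemma borel_measurable_matrix_vector_mult [measurable]:
  "(\<lambda>x. A *v x) \<in> borel_measurable borel" for A :: "real ^ 'n ^ 'm"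
  by (intro borel_measurable_continuous_onI linear_continuous_on) simp

text \<open>The linear change of variables theorems of the library require a well-ordered index type, hence
  the direct argument by elementary matrices.\<close>

lemma nn_integral_lborel_matrix:
  fixes A :: "real ^ 'n ^ 'n" and g :: "real ^ 'n \<Rightarrow> ennreal"
  assumes "det A \<noteq> 0" "g \<in> borel_measurable borel"
  shows "(\<integral>\<^sup>+x. g x \<partial>lborel) = \<bar>det A\<bar> * (\<integral>\<^sup>+x. g (A *v x) \<partial>lborel)"
proof -
  \<comment> \<open>The induction statement is vacuous for singular matrices. It quantifies over
    \<open>g\<close> because, for a product \<open>A ** B\<close>, the hypothesis on
    \<open>B\<close> is applied to \<open>g\<close> composed with \<open>A\<close>.\<close>
  have "det A \<noteq> 0 \<longrightarrow> (\<forall>g :: real ^ 'n \<Rightarrow> ennreal. g \<in> borel_measurable borel \<longrightarrow>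
      (\<integral>\<^sup>+x. g x \<partial>lborel) = \<bar>det A\<bar> * (\<integral>\<^sup>+x. g (A *v x) \<partial>lborel))" (is "?P A")
  proof (induction A rule: induct_matrix_elementary)
    fix A B :: "real ^ 'n ^ 'n"
    assume A: "?P A" and B: "?P B"
    show "?P (A ** B)"
    proof (intro impI allI)
      fix g :: "real ^ 'n \<Rightarrow> ennreal"
      assume "det (A ** B) \<noteq> 0" and [measurable]: "g \<in> borel_measurable borel"
      then have nz: "det A \<noteq> 0" "det B \<noteq> 0"
        by (auto simp: det_mul)
      have "(\<integral>\<^sup>+x. g x \<partial>lborel) = \<bar>det A\<bar> * (\<integral>\<^sup>+x. g (A *v x) \<partial>lborel)"
        using nz(1) by (rule A[rule_format]) measurable
      also have "(\<integral>\<^sup>+x. g (A *v x) \<partial>lborel) = \<bar>det B\<bar> * (\<integral>\<^sup>+x. g (A *v (B *v x)) \<partial>lborel)"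
        using nz(2) by (rule B[rule_format]) measurable
      also have "\<bar>det A\<bar> * (\<bar>det B\<bar> * (\<integral>\<^sup>+x. g (A *v (B *v x)) \<partial>lborel))
          = \<bar>det (A ** B)\<bar> * (\<integral>\<^sup>+x. g ((A ** B) *v x) \<partial>lborel)"
        by (simp only: det_mul abs_mult ennreal_mult abs_ge_zero mult.assoc matrix_vector_mul_assoc)
      finally show "(\<integral>\<^sup>+x. g x \<partial>lborel) = \<bar>det (A ** B)\<bar> * (\<integral>\<^sup>+x. g ((A ** B) *v x) \<partial>lborel)" .
    qed
  next
    fix A :: "real ^ 'n ^ 'n" and i
    assume "row i A = 0"
    then show "?P A"
      by (simp add: det_zero_row)
  next
    fix A :: "real ^ 'n ^ 'n"
    assume diag: "\<And>i j. i \<noteq> j \<Longrightarrow> A $ i $ j = 0"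
    then have det: "det A = (\<Prod>i\<in>UNIV. A $ i $ i)"
      by (rule det_diagonal)
    show "?P A"
    proof (intro impI allI)
      fix g :: "real ^ 'n \<Rightarrow> ennreal"
      assume "det A \<noteq> 0" and [measurable]: "g \<in> borel_measurable borel"
      then have nz: "A $ i $ i \<noteq> 0" for i
        by (simp add: det)
      \<comment> \<open>The diagonal entries, indexed by basis vectors instead of coordinates, are
        the scaling factors in \<open>lborel_affine_euclidean\<close>; the summand 0 below is its
        translation part.\<close>
      define c where "c b = b \<bullet> (A *v b)" for b :: "real ^ 'n"
      have c: "c (axis i 1) = A $ i $ i" for i
        by (simp add: c_def inner_axis' matrix_vector_mul_component inner_axis)
      have "A *v x = 0 + (\<Sum>j\<in>Basis. (c j * (x \<bullet> j)) *\<^sub>R j)" for x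
      proof -
        have "A *v x = (\<chi> i. A $ i $ i * x $ i)"
          unfolding vec_eq_iff matrix_vector_mult_def
          by (auto intro!: trans[OF sum.mono_neutral_right[of UNIV "{_}"]]) (metis diag)
        also have "\<dots> = (\<Sum>j\<in>Basis. (c j * (x \<bullet> j)) *\<^sub>R j)"
        proof (rule euclidean_eqI)
          fix b :: "real ^ 'n"
          assume b: "b \<in> Basis"
          then obtain i where "b = axis i 1"
            by (auto simp: Basis_vec_def)
          with b show "(\<chi> i. A $ i $ i * x $ i) \<bullet> b = (\<Sum>j\<in>Basis. (c j * (x \<bullet> j)) *\<^sub>R j) \<bullet> b"
            by (simp only: inner_sum_left_Basis) (simp add: c inner_axis)
        qed
        finally show ?thesis by simp
      qed
      moreover have "c j \<noteq> 0" if "j \<in> Basis" for j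
        using that nz by (auto simp: Basis_vec_def c)
      moreover have "(\<Prod>j\<in>Basis. \<bar>c j\<bar>) = \<bar>det A\<bar>"
        by (simp add: prod_Basis_cart c det abs_prod)
      ultimately have "lborel = density (distr lborel borel (\<lambda>x. A *v x)) (\<lambda>_. \<bar>det A\<bar>)"
        using lborel_affine_euclidean[of c 0] by simp
      then have "(\<integral>\<^sup>+x. g x \<partial>lborel) = (\<integral>\<^sup>+x. g x \<partial>density (distr lborel borel (\<lambda>x. A *v x)) (\<lambda>_. \<bar>det A\<bar>))"
        by simp
      then show "(\<integral>\<^sup>+x. g x \<partial>lborel) = \<bar>det A\<bar> * (\<integral>\<^sup>+x. g (A *v x) \<partial>lborel)"
        by (simp add: nn_integral_density nn_integral_distr nn_integral_cmult)
    qed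
  next
    fix m n :: 'n
    assume "m \<noteq> n"
    let ?p = "Transposition.transpose m n"
    let ?A = "\<chi> i j. mat 1 $ i $ ?p j :: real ^ 'n ^ 'n"
    have p: "?p permutes UNIV"
      by (simp add: permutes_swap_id)
    have "\<bar>det ?A\<bar> = 1"
      by (simp add: det_permute_columns p sign_swap_id abs_mult)
    moreover have "?A *v x = (\<chi> i. x $ ?p i)" for x
    proof -
      have "(\<Sum>j\<in>UNIV. mat 1 $ i $ ?p j * x $ j) = (\<Sum>j\<in>UNIV. if j = ?p i then x $ j else 0)" for i
        by (intro sum.cong) (auto simp: mat_def)
      then show ?thesis
        by (simp add: vec_eq_iff matrix_vector_mult_def)
    qed
    moreover have "(\<integral>\<^sup>+x. g x \<partial>lborel) = (\<integral>\<^sup>+x. g (\<chi> i. x $ ?p i) \<partial>lborel)"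
      if [measurable]: "g \<in> borel_measurable borel" for g :: "real ^ 'n \<Rightarrow> ennreal"
      by (subst (1) lborel_distr_permute_cart[OF p, symmetric], rule nn_integral_distr)
        (auto intro!: borel_measurable_continuous_onI continuous_intros)
    ultimately show "?P ?A"
      by simp
  next
    fix m n :: 'n and c :: real
    assume mn: "m \<noteq> n"
    let ?A = "\<chi> i j. if i = m \<and> j = n then c else of_bool (i = j) :: real ^ 'n ^ 'n"
    have "?A *v x = x + (c * (x \<bullet> axis n 1)) *\<^sub>R axis m 1" for x
    proof -
      \<comment> \<open>As \<open>m \<noteq> n\<close>, the entry \<open>c\<close> is off the
        diagonal, so each row sum splits into the identity part and a part supported at column
        \<open>n\<close>.\<close>
      have "(\<Sum>j\<in>UNIV. (if i = m \<and> j = n then c else of_bool (i = j)) * x $ j)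
          = (\<Sum>j\<in>UNIV. (if j = i then x $ j else 0) + (if j = n then (if i = m then c else 0) * x $ j else 0))" for i
        using mn by (intro sum.cong) auto
      then show ?thesis
        unfolding inner_axis by (auto simp: vec_eq_iff matrix_vector_mult_def sum.distrib axis_def)
    qed
    then show "?P ?A"
      using mn nn_integral_lborel_shear[of "axis m 1" "axis n (1::real)" _ c]
      by (simp add: det_shear axis_eq_axis)
  qed
  with assms show ?thesis
    by blast
qed

text \<open>The preceding formula on indicator functions. As an identity of measures it carries over
  to Bochner integrals of vector-valued functions.\<close>

lemma lborel_matrix:
  fixes A :: "real ^ 'n ^ 'n"
  assumes "det A \<noteq> 0"
  shows "lborel = density (distr lborel borel (\<lambda>x. A *v x)) (\<lambda>_. \<bar>det A\<bar>)"
proof (rule measure_eqI)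
  fix X :: "(real ^ 'n) set"
  assume "X \<in> sets lborel"
  then have [measurable]: "X \<in> sets borel"
    by simp
  have "emeasure lborel X = (\<integral>\<^sup>+x. indicator X x \<partial>lborel)"
    by simp
  also have "\<dots> = \<bar>det A\<bar> * (\<integral>\<^sup>+x. indicator X (A *v x) \<partial>lborel)"
    using assms by (rule nn_integral_lborel_matrix) measurable
  also have "(\<integral>\<^sup>+x. indicator X (A *v x) \<partial>lborel) = (\<integral>\<^sup>+x. indicator X x \<partial>distr lborel borel (\<lambda>x. A *v x))"
    by (subst nn_integral_distr) simp_all
  also have "\<bar>det A\<bar> * \<dots> = emeasure (density (distr lborel borel (\<lambda>x. A *v x)) (\<lambda>_. \<bar>det A\<bar>)) X"
    by (simp add: emeasure_density nn_integral_cmult)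
  finally show "emeasure lborel X = emeasure (density (distr lborel borel (\<lambda>x. A *v x)) (\<lambda>_. \<bar>det A\<bar>)) X" .
qed simp

lemma integral_lborel_matrix:
  fixes A :: "real ^ 'n ^ 'n" and f :: "real ^ 'n \<Rightarrow> 'b::{banach, second_countable_topology}"
  assumes "det A \<noteq> 0" and [measurable]: "f \<in> borel_measurable borel"
  shows "(\<integral>x. f x \<partial>lborel) = \<bar>det A\<bar> *\<^sub>R (\<integral>x. f (A *v x) \<partial>lborel)"
  by (subst lborel_matrix[OF assms(1)]) (simp add: integral_density integral_distr)

subsection \<open>Hausdorff convergence of convex bodies\<close>

text \<open>Compactness bounds the distance functions, so the real suprema in the definition really
  are upper bounds.\<close>

lemma infdist_le_hausdorff_distance:
  assumes "compact A" "compact B"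
  shows "a \<in> A \<Longrightarrow> infdist a B \<le> hausdorff_distance A B"
    and "b \<in> B \<Longrightarrow> infdist b A \<le> hausdorff_distance A B"
proof -
  have bdd: "bdd_above ((\<lambda>x. infdist x C) ` D)" if "compact D" for C D :: "'a set"
    using that by (intro bounded_imp_bdd_above compact_imp_bounded compact_continuous_image continuous_intros)
  show "a \<in> A \<Longrightarrow> infdist a B \<le> hausdorff_distance A B"
    unfolding hausdorff_distance_def by (rule max.coboundedI1) (rule cSUP_upper[OF _ bdd[OF assms(1)]])
  show "b \<in> B \<Longrightarrow> infdist b A \<le> hausdorff_distance A B"
    unfolding hausdorff_distance_def by (rule max.coboundedI2) (rule cSUP_upper[OF _ bdd[OF assms(2)]])
qed

text \<open>The point \<open>z\<close> is reached from \<open>y\<close> by moving the distance \<open>r\<close> along the normal of a hyperplane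
  separating \<open>y\<close> from \<open>S\<close>, away from \<open>S\<close>.\<close>

lemma far_point_if_not_in_convex:
  fixes S :: "'a::euclidean_space set"
  assumes "convex S" "closed S" "S \<noteq> {}" "y \<notin> S" "r \<ge> 0"
  obtains z where "z \<in> cball y r" "r \<le> infdist z S"
proof -
  obtain a b where ab: "a \<bullet> y < b" "\<And>x. x \<in> S \<Longrightarrow> b < a \<bullet> x"
    using separating_hyperplane_closed_point assms by metis
  have "a \<noteq> 0"
    using ab assms(3) by force
  define z where "z = y - (r / norm a) *\<^sub>R a"
  obtain w where w: "w \<in> S" "infdist z S = dist z w"
    using infdist_attains_inf assms by metis
  \<comment> \<open>From \<open>z\<close>, the hyperplane lies beyond \<open>y\<close>, and
    \<open>w\<close> lies beyond the hyperplane. So \<open>w - z\<close> has at least the component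
    along \<open>a\<close> that \<open>y - z\<close> has, and Cauchy-Schwarz bounds
    \<open>dist z w\<close> from below.\<close>
  have "r * norm a = a \<bullet> (y - z)"
    using \<open>a \<noteq> 0\<close> by (simp add: z_def power2_norm_eq_inner[symmetric] power2_eq_square)
  also have "\<dots> \<le> a \<bullet> (w - z)"
    using ab w by (force simp: inner_diff_right)
  also have "\<dots> \<le> dist z w * norm a"
    using norm_cauchy_schwarz[of a "w - z"] by (simp add: dist_norm norm_minus_commute mult.commute)
  finally have "r \<le> infdist z S"
    using \<open>a \<noteq> 0\<close> w by simp
  moreover have "z \<in> cball y r"
    using \<open>a \<noteq> 0\<close> \<open>r \<ge> 0\<close> by (simp add: z_def dist_norm)
  ultimately show thesis
    using that by blast
qed

lemma convex_bodiesD: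
  assumes "K \<in> convex_bodies"
  shows "convex K" "compact K" "closed K" "K \<noteq> {}" "K \<in> sets borel"
  using assms by (auto simp: convex_bodies_def compact_imp_closed borel_compact)

text \<open>On the frontier membership may alternate forever; elsewhere \<open>y\<close> has a
  positive margin, inside or outside \<open>K\<close>, which the Hausdorff distance eventually
  undercuts.\<close>

lemma eventually_in_iff_if_hausdorff:
  assumes Ks: "\<And>i. Ks i \<in> convex_bodies" and K: "K \<in> convex_bodies"
    and lim: "(\<lambda>i. hausdorff_distance (Ks i) K) \<longlonglongrightarrow> 0"
    and y: "y \<notin> frontier K"
  shows "\<forall>\<^sub>F i in sequentially. y \<in> Ks i \<longleftrightarrow> y \<in> K"
proof (cases "y \<in> K")
  case True
  then have "y \<in> interior K"
    using y closure_subset by (auto simp: frontier_def)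
  then obtain r where r: "r > 0" "cball y r \<subseteq> K"
    by (auto simp: mem_interior_cball)
  have "\<forall>\<^sub>F i in sequentially. hausdorff_distance (Ks i) K < r"
    using order_tendstoD(2)[OF lim] r by blast
  then show ?thesis
  proof eventually_elim
    case (elim i)
    show ?case
    proof (rule ccontr)
      assume "(y \<in> Ks i) \<noteq> (y \<in> K)"
      \<comment> \<open>This \<open>z\<close> lies in \<open>K\<close>, as \<open>cball y r\<close>
        does, yet has distance at least \<open>r\<close> from \<open>Ks i\<close>, more than the
        Hausdorff distance.\<close>
      then obtain z where "z \<in> cball y r" "r \<le> infdist z (Ks i)"
        using far_point_if_not_in_convex[of "Ks i" y r] convex_bodiesD[OF Ks[of i]] True r by auto
      then show False
        using r elim infdist_le_hausdorff_distance(2)[of "Ks i" K z]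
          convex_bodiesD[OF Ks[of i]] convex_bodiesD[OF K] by force
    qed
  qed
next
  case False
  then have "infdist y K > 0"
    using convex_bodiesD[OF K] infdist_pos_not_in_closed by blast
  then have "\<forall>\<^sub>F i in sequentially. hausdorff_distance (Ks i) K < infdist y K"
    using order_tendstoD(2)[OF lim] by blast
  then show ?thesis
    by eventually_elim
      (use False infdist_le_hausdorff_distance(1)[of _ K y] convex_bodiesD[OF Ks] convex_bodiesD[OF K] in force)
qed

text \<open>Provides the common ball for dominated convergence: a body at Hausdorff distance below 1
  from \<open>K\<close> stays within distance 1 of \<open>K\<close>.\<close>

lemma eventually_subset_cball_if_hausdorff:
  assumes Ks: "\<And>i. Ks i \<in> convex_bodies" and K: "K \<in> convex_bodies"
    and lim: "(\<lambda>i. hausdorff_distance (Ks i) K) \<longlonglongrightarrow> 0"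
  obtains R where "\<forall>\<^sub>F i in sequentially. Ks i \<subseteq> cball 0 R"
proof -
  obtain R where R: "K \<subseteq> cball 0 R"
    using compact_imp_bounded[OF convex_bodiesD(2)[OF K]] by (auto simp: bounded_iff subset_iff)
  have "\<forall>\<^sub>F i in sequentially. hausdorff_distance (Ks i) K < 1"
    using order_tendstoD(2)[OF lim] by simp
  then have "\<forall>\<^sub>F i in sequentially. Ks i \<subseteq> cball 0 (R + 1)"
  proof eventually_elim
    case (elim i)
    show ?case
    proof
      fix a assume "a \<in> Ks i"
      then have "infdist a K < 1"
        using elim infdist_le_hausdorff_distance(1)[of "Ks i" K a]
          convex_bodiesD[OF Ks[of i]] convex_bodiesD[OF K] by force
      moreover obtain k where "k \<in> K" "infdist a K = dist a k"
        using infdist_attains_inf convex_bodiesD[OF K] by metis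
      ultimately show "a \<in> cball 0 (R + 1)"
        using R norm_triangle_sub[of a k] by (force simp: dist_norm)
    qed
  qed
  then show thesis
    using that by blast
qed

subsection \<open>The Laplace transform\<close>

text \<open>The Bochner integral defaults to 0 on non-integrable functions; this ensures that the
  transform is a genuine integral.\<close>

lemma set_integrable_exp_inner:
  fixes K :: "(real ^ 'n) set"
  assumes "compact K"
  shows "set_integrable lborel K (\<lambda>y. exp (- (x \<bullet> y)))"
  unfolding set_integrable_def using assms
  by (intro borel_integrable_compact continuous_intros)

text \<open>Set and argument vary together, so that one use of dominated convergence serves both
  continuities: in the body for constant \<open>xs\<close>, in the argument for constant
  \<open>Ks\<close>.\<close>

lemma tendsto_laplace_transform:
  fixes K :: "(real ^ 'n) set"
  assumes meas [measurable]: "\<And>i. Ks i \<in> sets borel" "K \<in> sets borel"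
    and bdd: "\<And>i. Ks i \<subseteq> cball 0 R"
    and ae: "AE y in lborel. \<forall>\<^sub>F i in sequentially. y \<in> Ks i \<longleftrightarrow> y \<in> K"
    and xs: "xs \<longlonglongrightarrow> x"
  shows "(\<lambda>i. laplace_transform (Ks i) (xs i)) \<longlonglongrightarrow> laplace_transform K x"
proof -
  obtain B where B: "\<And>i. norm (xs i) \<le> B"
    using xs convergent_imp_Bseq[of xs] by (auto simp: convergent_def Bseq_def)
  show ?thesis
    unfolding laplace_transform_def set_lebesgue_integral_def
  proof (rule integral_dominated_convergence)
    \<comment> \<open>By Cauchy-Schwarz the exponent is at most \<open>B * R\<close> on the ball,
      which gives a dominating function constant there.\<close>
    show "integrable lborel (\<lambda>y::real ^ 'n. indicator (cball 0 R) y *\<^sub>R exp (B * R))"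
      by (intro borel_integrable_compact continuous_intros) auto
    show "AE y in lborel. (\<lambda>i. indicator (Ks i) y *\<^sub>R exp (- (xs i \<bullet> y))) \<longlonglongrightarrow> indicator K y *\<^sub>R exp (- (x \<bullet> y))"
      using ae
    proof eventually_elim
      case (elim y)
      have "(\<lambda>i. indicator K y *\<^sub>R exp (- (xs i \<bullet> y))) \<longlonglongrightarrow> indicator K y *\<^sub>R exp (- (x \<bullet> y))"
        by (intro tendsto_intros xs)
      then show ?case
        by (rule Lim_transform_eventually) (use elim in eventually_elim, auto simp: indicator_def)
    qed
    show "AE y in lborel. norm (indicator (Ks i) y *\<^sub>R exp (- (xs i \<bullet> y))) \<le> indicator (cball 0 R) y *\<^sub>R exp (B * R)" for i
    proof (intro AE_I2)
      fix y
      show "norm (indicator (Ks i) y *\<^sub>R exp (- (xs i \<bullet> y))) \<le> indicator (cball 0 R) y *\<^sub>R exp (B * R)"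
      proof (cases "y \<in> Ks i")
        case True
        then have y: "norm y \<le> R"
          using bdd[of i] by auto
        have "- (xs i \<bullet> y) \<le> norm (xs i) * norm y"
          using Cauchy_Schwarz_ineq2[of "xs i" y] by linarith
        also have "\<dots> \<le> B * R"
          using B[of i] y by (intro mult_mono order_trans[OF norm_ge_zero B]) auto
        finally show ?thesis
          using True y by simp
      qed simp
    qed
  qed measurable
qed

lemma continuous_on_laplace_transform:
  fixes K :: "(real ^ 'n) set"
  assumes "compact K"
  shows "continuous_on UNIV (laplace_transform K)"
proof -
  obtain R where "K \<subseteq> cball 0 R"
    using compact_imp_bounded[OF assms] by (auto simp: bounded_iff subset_iff)
  then have "(\<lambda>i. laplace_transform K (xs i)) \<longlonglongrightarrow> laplace_transform K x" if "xs \<longlonglongrightarrow> x" for xs x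
    using that assms by (intro tendsto_laplace_transform) (auto simp: borel_compact)
  then show ?thesis
    by (auto simp: continuous_on_sequentially o_def)
qed

lemma hausdorff_continuous_laplace_transform:
  "hausdorff_continuous (laplace_transform :: (real ^ 'n) set \<Rightarrow> real ^ 'n \<Rightarrow> real)"
  unfolding hausdorff_continuous_def
proof (intro allI impI)
  fix x :: "real ^ 'n" and Ks and K :: "(real ^ 'n) set"
  assume "\<forall>i. Ks i \<in> convex_bodies" and K: "K \<in> convex_bodies"
    and lim: "(\<lambda>i. hausdorff_distance (Ks i) K) \<longlonglongrightarrow> 0"
  then have Ks: "Ks i \<in> convex_bodies" for i
    by blast
  obtain R where "\<forall>\<^sub>F i in sequentially. Ks i \<subseteq> cball 0 R"
    using eventually_subset_cball_if_hausdorff[OF Ks K lim] by blast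
  \<comment> \<open>Discarding the first \<open>N\<close> bodies makes the bound hold for every
    index, as the convergence lemma demands.\<close>
  then obtain N where N: "\<And>i. i \<ge> N \<Longrightarrow> Ks i \<subseteq> cball 0 R"
    by (auto simp: eventually_sequentially)
  \<comment> \<open>The frontier of a convex set is negligible; being Borel, it is then null for
    \<open>lborel\<close> and not only for its completion.\<close>
  have "frontier K \<in> null_sets lborel"
    using negligible_convex_frontier[OF convex_bodiesD(1)[OF K]]
    by (auto simp: negligible_iff_null_sets null_sets_completion_iff)
  then have "AE y in lborel. y \<notin> frontier K"
    by (rule AE_not_in)
  then have "AE y in lborel. \<forall>\<^sub>F i in sequentially. y \<in> Ks (i + N) \<longleftrightarrow> y \<in> K"
    by eventually_elim
      (rule eventually_sequentially_seg[THEN iffD2, OF eventually_in_iff_if_hausdorff[OF Ks K lim]])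
  then have "(\<lambda>i. laplace_transform (Ks (i + N)) x) \<longlonglongrightarrow> laplace_transform K x"
    using N convex_bodiesD(5)[OF K] convex_bodiesD(5)[OF Ks] by (intro tendsto_laplace_transform[where R = R]) auto
  then show "(\<lambda>i. laplace_transform (Ks i) x) \<longlonglongrightarrow> laplace_transform K x"
    by (rule LIMSEQ_offset)
qed

text \<open>Substituting \<open>\<phi> *v y\<close> for the integration variable produces the
  determinant, and the adjoint identity moves \<open>\<phi>\<close> to the argument
  \<open>x\<close>.\<close>

lemma laplace_transform_matrix_image:
  fixes K :: "(real ^ 'n) set" and \<phi> :: "real ^ 'n ^ 'n"
  assumes "compact K" "det \<phi> \<noteq> 0"
  shows "laplace_transform ((\<lambda>y. \<phi> *v y) ` K) x = \<bar>det \<phi>\<bar> * laplace_transform K (transpose \<phi> *v x)"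
proof -
  have "inj ((*v) \<phi>)"
    using assms(2) by (simp add: inj_matrix_vector_mult invertible_det_nz)
  then have ind: "indicator ((\<lambda>y. \<phi> *v y) ` K) (\<phi> *v y) = (indicator K y :: real)" for y
    by (auto simp: indicator_def inj_image_mem_iff)
  have [measurable]: "(\<lambda>y. \<phi> *v y) ` K \<in> sets borel"
    using assms(1) by (intro borel_compact compact_continuous_image linear_continuous_on) auto
  have "x \<bullet> (\<phi> *v y) = (transpose \<phi> *v x) \<bullet> y" for y
    by (simp add: dot_lmul_matrix)
  then show ?thesis
    unfolding laplace_transform_def set_lebesgue_integral_def
    by (subst integral_lborel_matrix[OF assms(2)]) (simp_all add: ind)
qed

text \<open>Lebesgue measure is its own image under translation by \<open>t\<close>, and the shifted
  exponential splits off a factor independent of \<open>y\<close>.\<close>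

lemma laplace_transform_translate:
  fixes K :: "(real ^ 'n) set"
  assumes "compact K"
  shows "laplace_transform ((\<lambda>y. y + t) ` K) x = exp (- (t \<bullet> x)) * laplace_transform K x"
proof -
  have [measurable]: "(\<lambda>y. y + t) ` K \<in> sets borel"
    using assms by (intro borel_compact compact_continuous_image continuous_intros)
  have ind: "indicator ((\<lambda>y. y + t) ` K) (t + y) = (indicator K y :: real)" for y
    by (auto simp: indicator_def add.commute[of t])
  have exp: "exp (- (x \<bullet> (t + y))) = exp (- (t \<bullet> x)) * exp (- (x \<bullet> y))" for y
    by (simp add: inner_add_right inner_commute[of t] flip: exp_add)
  have "laplace_transform ((\<lambda>y. y + t) ` K) x
      = (\<integral>y. indicator ((\<lambda>y. y + t) ` K) y *\<^sub>R exp (- (x \<bullet> y)) \<partial>distr lborel borel ((+) t))"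
    unfolding laplace_transform_def set_lebesgue_integral_def by (simp add: lborel_distr_plus)
  also have "\<dots> = (\<integral>y. exp (- (t \<bullet> x)) * (indicator K y *\<^sub>R exp (- (x \<bullet> y))) \<partial>lborel)"
    by (subst integral_distr)
      (simp_all add: ind exp mult_ac)
  finally show ?thesis
    by (simp add: laplace_transform_def set_lebesgue_integral_def)
qed

text \<open>The indicators of union and intersection add up pointwise to those of \<open>K\<close>
  and \<open>L\<close>; compactness makes all four terms integrable.\<close>

lemma laplace_transform_Un_Int:
  fixes K :: "(real ^ 'n) set"
  assumes "compact K" "compact L"
  shows "laplace_transform (K \<union> L) x + laplace_transform (K \<inter> L) x = laplace_transform K x + laplace_transform L x"
proof -
  note int = set_integrable_exp_inner[unfolded set_integrable_def, where x = x]
  have "laplace_transform (K \<union> L) x + laplace_transform (K \<inter> L) x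
      = (\<integral>y. indicator (K \<union> L) y *\<^sub>R exp (- (x \<bullet> y)) + indicator (K \<inter> L) y *\<^sub>R exp (- (x \<bullet> y)) \<partial>lborel)"
    unfolding laplace_transform_def set_lebesgue_integral_def
    using assms by (intro Bochner_Integration.integral_add[symmetric] int) (auto intro: compact_Un compact_Int)
  also have "\<dots> = (\<integral>y. indicator K y *\<^sub>R exp (- (x \<bullet> y)) + indicator L y *\<^sub>R exp (- (x \<bullet> y)) \<partial>lborel)"
    by (intro Bochner_Integration.integral_cong) (auto simp: indicator_def)
  also have "\<dots> = laplace_transform K x + laplace_transform L x"
    unfolding laplace_transform_def set_lebesgue_integral_def
    using assms by (intro Bochner_Integration.integral_add int)
  finally show ?thesis .
qed

theorem theorem3p3:
  shows "(\<forall>K \<in> convex_bodies. \<forall>x :: real ^ 'n. set_integrable lborel K (\<lambda>y. exp (- (x \<bullet> y))))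
    \<and> (laplace_transform :: (real ^ 'n) set \<Rightarrow> real ^ 'n \<Rightarrow> real)
          \<in> convex_bodies \<rightarrow> {f. continuous_on UNIV f}
    \<and> hausdorff_continuous (laplace_transform :: (real ^ 'n) set \<Rightarrow> real ^ 'n \<Rightarrow> real)
    \<and> positively_GL_covariant (laplace_transform :: (real ^ 'n) set \<Rightarrow> real ^ 'n \<Rightarrow> real)
    \<and> log_translation_covariant (laplace_transform :: (real ^ 'n) set \<Rightarrow> real ^ 'n \<Rightarrow> real)
    \<and> valuation (laplace_transform :: (real ^ 'n) set \<Rightarrow> real ^ 'n \<Rightarrow> real)"
  unfolding positively_GL_covariant_def log_translation_covariant_def valuation_def
  by (auto simp: convex_bodiesD(2) set_integrable_exp_inner continuous_on_laplace_transform
      hausdorff_continuous_laplace_transform laplace_transform_matrix_image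
      laplace_transform_translate laplace_transform_Un_Int simp del: transpose_matrix_vector)

end
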